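(* The inner commensurator-normalizer property is not in general invariant under passing to finite index subgroups: there exist a group $\Gamma$ having the inner commensurator-normalizer property and a finite index subgroup $\Lambda\le\Gamma$ which does not have the inner commensurator-normalizer property.
   Context: Groups are countable. Two subgroups of a group are commensurable if their intersection has finite index in both. A subgroup $\Lambda<\Gamma$ is commensurated by $\Gamma$ if $\gamma\Lambda\gamma^{-1}$ is commensurable with $\Lambda$ for every $\gamma\in\Gamma$. A group $\Gamma$ has the inner commensurator-normalizer property if every subgroup of $\Gamma$ commensurated by $\Gamma$ is commensurable with a normal subgroup of $\Gamma$. *)

theory Defs
  imports "HOL-Algebra.Algebra" "HOL-Library.Countable_Set"
begin

definition finite_index :: "'a set \<Rightarrow> ('a, 'b) monoid_scheme \<Rightarrow> bool" where
  "finite_index H G \<longleftrightarrow> subgroup H G \<and> finite (rcosets\<^bsub>G\<^esub> H)"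

definition commensurable :: "('a, 'b) monoid_scheme \<Rightarrow> 'a set \<Rightarrow> 'a set \<Rightarrow> bool" where
  "commensurable G H K \<longleftrightarrow>
     subgroup H G \<and> subgroup K G \<and>
     finite_index (H \<inter> K) (G\<lparr>carrier := H\<rparr>) \<and>
     finite_index (H \<inter> K) (G\<lparr>carrier := K\<rparr>)"

definition commensurated :: "('a, 'b) monoid_scheme \<Rightarrow> 'a set \<Rightarrow> bool" where
  "commensurated G H \<longleftrightarrow>
     subgroup H G \<and>
     (\<forall>g \<in> carrier G. commensurable G ((g <#\<^bsub>G\<^esub> H) #>\<^bsub>G\<^esub> inv\<^bsub>G\<^esub> g) H)"

definition inner_commensurator_normalizer :: "('a, 'b) monoid_scheme \<Rightarrow> bool" where
  "inner_commensurator_normalizer G \<longleftrightarrow>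
     (\<forall>H. commensurated G H \<longrightarrow> (\<exists>N. N \<lhd> G \<and> commensurable G H N))"

end

theory Submission
  imports Defs
begin

text \<open>
  The example is the lamplighter group over the infinite dihedral group \<open>D\<close> acting on the
  integers: pairs of a finite set of lit lamps and an isometry of \<open>\<int>\<close>. In the index two subgroup
  of translations, the configurations supported on the nonnegative integers form a commensurated
  subgroup; it is infinite, but normal subgroups of the lamplighter group contain arbitrarily
  translated copies of each of their configurations, so none is commensurable with it. The
  reflections of \<open>D\<close> destroy this one-sidedness: an infinite group of configurations that is
  invariant up to finite error under the shift and under a reflection has finite index in all
  configurations. Hence a commensurated subgroup of the big group is commensurable with the trivial
  group, with the group of all configurations, or with the whole group. The last case occurs once
  it contains an element \<open>h\<close> with nonzero translation part, since for every configuration \<open>u\<close> it then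
  contains some \<open>u h\<^sup>k u\<^sup>-\<^sup>1 h\<^sup>-\<^sup>k\<close> with \<open>k > 0\<close>.
\<close>

subsection \<open>Commensurability via finitely many translates\<close>

text \<open>The condition says that \<open>H\<close> is covered by the right translates
  \<open>K f\<close> with \<open>f\<close> in a finite set. The translating elements may come from
  the whole group, which makes the notion monotone and easy to verify; for subgroups it expresses
  that \<open>H \<inter> K\<close> has finite index in \<open>H\<close>.\<close>

definition almost_subset :: "('a, 'b) monoid_scheme \<Rightarrow> 'a set \<Rightarrow> 'a set \<Rightarrow> bool" where
  "almost_subset G H K \<longleftrightarrow>
     (\<exists>F. finite F \<and> F \<subseteq> carrier G \<and> (\<forall>x\<in>H. \<exists>f\<in>F. x \<otimes>\<^bsub>G\<^esub> inv\<^bsub>G\<^esub> f \<in> K))"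

lemma almost_subsetI:
  "(\<And>x. x \<in> H \<Longrightarrow> \<exists>f\<in>F. x \<otimes>\<^bsub>G\<^esub> inv\<^bsub>G\<^esub> f \<in> K) \<Longrightarrow> finite F \<Longrightarrow> F \<subseteq> carrier G \<Longrightarrow>
    almost_subset G H K"
  unfolding almost_subset_def by blast

lemma almost_subset_mono:
  "almost_subset G H K \<Longrightarrow> H' \<subseteq> H \<Longrightarrow> K \<subseteq> K' \<Longrightarrow> almost_subset G H' K'"
  unfolding almost_subset_def by (meson subsetD)

context group
begin

lemma div_mult_cancel:
  assumes "x \<in> carrier G" "y \<in> carrier G" "f \<in> carrier G"
  shows "(x \<otimes> inv f) \<otimes> inv (y \<otimes> inv f) = x \<otimes> inv y"
  using assms by (simp add: inv_mult_group m_assoc inv_solve_left')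

text \<open>Each translate \<open>K f\<close> that meets \<open>H\<close> is also the translate by
  any element of \<open>H\<close> lying in it, so the representatives can be moved into
  \<open>H\<close>.\<close>

lemma almost_subset_reps:
  assumes "almost_subset G H K" "subgroup K G" "H \<subseteq> carrier G"
  obtains F where "finite F" "F \<subseteq> H" "\<And>x. x \<in> H \<Longrightarrow> \<exists>f\<in>F. x \<otimes> inv f \<in> K"
proof -
  obtain F where F: "finite F" "F \<subseteq> carrier G" "\<forall>x\<in>H. \<exists>f\<in>F. x \<otimes> inv f \<in> K"
    using assms(1) unfolding almost_subset_def by blast
  define E where "E = {f \<in> F. \<exists>y\<in>H. y \<otimes> inv f \<in> K}"
  have "\<forall>f\<in>E. \<exists>y. y \<in> H \<and> y \<otimes> inv f \<in> K"
    unfolding E_def by blast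
  then obtain r where r: "\<And>f. f \<in> E \<Longrightarrow> r f \<in> H \<and> r f \<otimes> inv f \<in> K"
    by metis
  show thesis
  proof
    show "finite (r ` E)" using F(1) by (simp add: E_def)
    show "r ` E \<subseteq> H" using r by blast
    fix x assume x: "x \<in> H"
    then obtain f where f: "f \<in> F" "x \<otimes> inv f \<in> K" using F(3) by blast
    then have fE: "f \<in> E" using x by (auto simp: E_def)
    have "(x \<otimes> inv f) \<otimes> inv (r f \<otimes> inv f) \<in> K"
      using f r[OF fE] assms(2) by (simp add: subgroup.m_closed subgroup.m_inv_closed)
    then have "x \<otimes> inv (r f) \<in> K"
      using div_mult_cancel[of x "r f" f] x r[OF fE] f(1) F(2) assms(3) by (simp add: subset_eq)
    with fE show "\<exists>f\<in>r ` E. x \<otimes> inv f \<in> K" by blast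
  qed
qed

text \<open>The cosets of \<open>H \<inter> K\<close> in \<open>H\<close> correspond to the
  translates of \<open>K\<close> that meet \<open>H\<close>: once the representative
  \<open>f\<close> is in \<open>H\<close>, the quotient of \<open>x\<close> by \<open>f\<close> lies
  in \<open>H\<close> as well as in \<open>K\<close>.\<close>

lemma finite_index_Int_iff:
  assumes H: "subgroup H G" and K: "subgroup K G"
  shows "finite_index (H \<inter> K) (G\<lparr>carrier := H\<rparr>) \<longleftrightarrow> almost_subset G H K"
proof -
  have HC: "H \<subseteq> carrier G" by (rule subgroup.subset[OF H])
  have HK: "subgroup (H \<inter> K) G" by (rule subgroups_Inter_pair[OF H K])
  have "subgroup (H \<inter> K) (G\<lparr>carrier := H\<rparr>)"
    using subgroup_incl[OF HK H] by simp
  moreover have "rcosets\<^bsub>G\<lparr>carrier := H\<rparr>\<^esub> (H \<inter> K) = (\<lambda>x. (H \<inter> K) #> x) ` H"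
    by (auto simp: RCOSETS_def r_coset_def)
  ultimately have "finite_index (H \<inter> K) (G\<lparr>carrier := H\<rparr>) \<longleftrightarrow>
      finite ((\<lambda>x. (H \<inter> K) #> x) ` H)"
    by (simp add: finite_index_def)
  also have "\<dots> \<longleftrightarrow> almost_subset G H K"
  proof
    assume "finite ((\<lambda>x. (H \<inter> K) #> x) ` H)"
    then obtain F where F: "F \<subseteq> H" "finite F"
      "(\<lambda>x. (H \<inter> K) #> x) ` H = (\<lambda>x. (H \<inter> K) #> x) ` F"
      by (meson finite_subset_image order_refl)
    have "\<exists>f\<in>F. x \<otimes> inv f \<in> K" if x: "x \<in> H" for x
    proof -
      obtain f where f: "f \<in> F" "(H \<inter> K) #> x = (H \<inter> K) #> f"
        using F(3) x by (metis imageE imageI)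
      have "x \<in> (H \<inter> K) #> f"
        using rcos_self[OF _ HK, of x] x HC f(2) by auto
      then obtain k where k: "k \<in> H \<inter> K" "x = k \<otimes> f" by (auto simp: r_coset_def)
      have "k \<in> carrier G" "f \<in> carrier G" using k f F HC by auto
      then have "x \<otimes> inv f = k" using k(2) by (simp add: m_assoc)
      then show ?thesis using f(1) k(1) by auto
    qed
    with F(1,2) HC show "almost_subset G H K"
      unfolding almost_subset_def by (intro exI[of _ F]) auto
  next
    assume "almost_subset G H K"
    then obtain F where F: "finite F" "F \<subseteq> H" "\<And>x. x \<in> H \<Longrightarrow> \<exists>f\<in>F. x \<otimes> inv f \<in> K"
      using almost_subset_reps[OF _ K HC] by blast
    have "(\<lambda>x. (H \<inter> K) #> x) ` H \<subseteq> (\<lambda>x. (H \<inter> K) #> x) ` F"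
    proof
      fix c assume "c \<in> (\<lambda>x. (H \<inter> K) #> x) ` H"
      then obtain x where x: "x \<in> H" "c = (H \<inter> K) #> x" by blast
      obtain f where f: "f \<in> F" "x \<otimes> inv f \<in> K" using F(3) x by blast
      have "x \<otimes> inv f \<in> H \<inter> K"
        using x f F(2) H by (auto intro: subgroup.m_closed subgroup.m_inv_closed)
      moreover have "x \<in> carrier G" "f \<in> carrier G" using x f F HC by auto
      ultimately have "(H \<inter> K) #> x = (H \<inter> K) #> f"
        using coset_mult_inv1[of "H \<inter> K" x f] coset_join2[OF _ HK] HC by auto
      with f x show "c \<in> (\<lambda>x. (H \<inter> K) #> x) ` F" by blast
    qed
    then show "finite ((\<lambda>x. (H \<inter> K) #> x) ` H)"
      using F(1) finite_surj by blast
  qed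
  finally show ?thesis .
qed

lemma commensurable_iff:
  "commensurable G H K \<longleftrightarrow>
     subgroup H G \<and> subgroup K G \<and> almost_subset G H K \<and> almost_subset G K H"
  unfolding commensurable_def using finite_index_Int_iff[of H K] finite_index_Int_iff[of K H]
  by (auto simp: Int_commute)

lemma conjugate_eq_image: "(g <#\<^bsub>G\<^esub> H) #>\<^bsub>G\<^esub> inv g = (\<lambda>x. g \<otimes> x \<otimes> inv g) ` H"
  by (auto simp: l_coset_def r_coset_def)

lemma subgroup_conjugate:
  assumes "subgroup H G" "g \<in> carrier G"
  shows "subgroup ((\<lambda>x. g \<otimes> x \<otimes> inv g) ` H) G"
proof (rule subgroupI)
  have HC: "H \<subseteq> carrier G" by (rule subgroup.subset[OF assms(1)])
  show "(\<lambda>x. g \<otimes> x \<otimes> inv g) ` H \<subseteq> carrier G" using HC assms(2) by auto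
  show "(\<lambda>x. g \<otimes> x \<otimes> inv g) ` H \<noteq> {}" using subgroup.one_closed[OF assms(1)] by auto
  fix a assume "a \<in> (\<lambda>x. g \<otimes> x \<otimes> inv g) ` H"
  then obtain x where x: "x \<in> H" "a = g \<otimes> x \<otimes> inv g" by blast
  have xC: "x \<in> carrier G" using x HC by auto
  have "inv a = g \<otimes> inv x \<otimes> inv g"
    using x xC assms(2) by (simp add: inv_mult_group m_assoc)
  then show "inv a \<in> (\<lambda>x. g \<otimes> x \<otimes> inv g) ` H"
    using x subgroup.m_inv_closed[OF assms(1)] by blast
  fix b assume "b \<in> (\<lambda>x. g \<otimes> x \<otimes> inv g) ` H"
  then obtain y where y: "y \<in> H" "b = g \<otimes> y \<otimes> inv g" by blast
  have yC: "y \<in> carrier G" using y HC by auto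
  have "a \<otimes> b = g \<otimes> (x \<otimes> y) \<otimes> inv g"
    using x xC y yC assms(2) by (simp add: m_assoc inv_solve_left')
  then show "a \<otimes> b \<in> (\<lambda>x. g \<otimes> x \<otimes> inv g) ` H"
    using x y subgroup.m_closed[OF assms(1)] by blast
qed

text \<open>One of the two almost inclusions suffices for all \<open>g\<close> together: conjugating
  by \<open>g\<close> the one that belongs to \<open>inv g\<close> yields the other one for
  \<open>g\<close>.\<close>

lemma commensurated_iff:
  "commensurated G H \<longleftrightarrow>
     subgroup H G \<and> (\<forall>g\<in>carrier G. almost_subset G ((\<lambda>x. g \<otimes> x \<otimes> inv g) ` H) H)"
proof -
  have "almost_subset G H ((\<lambda>x. g \<otimes> x \<otimes> inv g) ` H)"
    if H: "subgroup H G" and g: "g \<in> carrier G"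
      and conj: "\<forall>g\<in>carrier G. almost_subset G ((\<lambda>x. g \<otimes> x \<otimes> inv g) ` H) H" for g
  proof -
    have HC: "H \<subseteq> carrier G" by (rule subgroup.subset[OF H])
    have "almost_subset G ((\<lambda>x. inv g \<otimes> x \<otimes> g) ` H) H"
      using conj g by (metis inv_closed inv_inv)
    then obtain F where F: "finite F" "F \<subseteq> carrier G"
      "\<And>x. x \<in> H \<Longrightarrow> \<exists>f\<in>F. (inv g \<otimes> x \<otimes> g) \<otimes> inv f \<in> H"
      unfolding almost_subset_def by auto
    have "\<exists>f\<in>(\<lambda>f. g \<otimes> f \<otimes> inv g) ` F. x \<otimes> inv f \<in> (\<lambda>x. g \<otimes> x \<otimes> inv g) ` H"
      if x: "x \<in> H" for x
    proof -
      obtain f where f: "f \<in> F" "(inv g \<otimes> x \<otimes> g) \<otimes> inv f \<in> H" using F(3) x by blast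
      have "f \<in> carrier G" "x \<in> carrier G" using f F x HC by auto
      moreover have "g \<otimes> (inv g \<otimes> y) = y" if "y \<in> carrier G" for y
        using g that by (metis inv_closed l_one m_assoc r_inv)
      ultimately have "x \<otimes> inv (g \<otimes> f \<otimes> inv g) = g \<otimes> ((inv g \<otimes> x \<otimes> g) \<otimes> inv f) \<otimes> inv g"
        using g by (simp add: m_assoc inv_mult_group)
      with f show ?thesis by blast
    qed
    moreover have "(\<lambda>f. g \<otimes> f \<otimes> inv g) ` F \<subseteq> carrier G" using F(2) g by auto
    ultimately show ?thesis using F(1) unfolding almost_subset_def by blast
  qed
  then show ?thesis
    unfolding commensurated_def conjugate_eq_image commensurable_iff
    using subgroup_conjugate by blast
qed

text \<open>By the pigeonhole principle two powers of \<open>x\<close> lie in the same translate of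
  \<open>K\<close>, and their quotient is a positive power in \<open>K\<close>.\<close>

lemma almost_subset_pow:
  assumes "almost_subset G S K" "subgroup K G" "x \<in> carrier G" "\<And>k::nat. x [^] k \<in> S"
  obtains k :: nat where "k > 0" "x [^] k \<in> K"
proof -
  obtain F where F: "finite F" "F \<subseteq> carrier G" "\<forall>x\<in>S. \<exists>f\<in>F. x \<otimes> inv f \<in> K"
    using assms(1) unfolding almost_subset_def by blast
  then have "\<forall>k::nat. \<exists>f. f \<in> F \<and> x [^] k \<otimes> inv f \<in> K"
    using assms(4) by blast
  then obtain r where r: "\<And>k::nat. r k \<in> F \<and> x [^] k \<otimes> inv (r k) \<in> K"
    by metis
  have "range r \<subseteq> F" using r by blast
  then have "\<not> inj r" using F(1) finite_subset range_inj_infinite by blast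
  then obtain i j where ij: "i < j" "r i = r j"
    unfolding inj_def by (metis nat_neq_iff)
  have "(x [^] j \<otimes> inv (r j)) \<otimes> inv (x [^] i \<otimes> inv (r j)) \<in> K"
    using r[of i] r[of j] ij(2) assms(2) by (simp add: subgroup.m_closed subgroup.m_inv_closed)
  then have "x [^] j \<otimes> inv (x [^] i) \<in> K"
    using div_mult_cancel[of "x [^] j" "x [^] i" "r j"] assms(3) F(2) r[of j] by (simp add: subset_eq)
  moreover have "x [^] j = x [^] (j - i) \<otimes> x [^] i"
    using nat_pow_mult[OF assms(3), of "j - i" i] ij(1) by simp
  ultimately have "x [^] (j - i) \<in> K"
    using assms(3) by (simp add: m_assoc)
  with ij(1) show thesis using that[of "j - i"] by simp
qed

lemma subset_imp_almost_subset: "H \<subseteq> K \<Longrightarrow> H \<subseteq> carrier G \<Longrightarrow> almost_subset G H K"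
  unfolding almost_subset_def by (intro exI[of _ "{\<one>}"]) (auto simp: subset_eq)

lemma almost_subset_Int:
  assumes "almost_subset G H K" "subgroup H G" "subgroup K G"
  shows "almost_subset G H (K \<inter> H)"
proof -
  have HC: "H \<subseteq> carrier G" by (rule subgroup.subset[OF assms(2)])
  obtain F where F: "finite F" "F \<subseteq> H" "\<And>x. x \<in> H \<Longrightarrow> \<exists>f\<in>F. x \<otimes> inv f \<in> K"
    using almost_subset_reps[OF assms(1,3) HC] by blast
  show ?thesis
  proof (rule almost_subsetI)
    fix x assume x: "x \<in> H"
    then obtain f where f: "f \<in> F" "x \<otimes> inv f \<in> K" using F(3) by blast
    have "x \<otimes> inv f \<in> H"
      by (rule subgroup.m_closed[OF assms(2) x subgroup.m_inv_closed[OF assms(2)]])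
         (use f F(2) in blast)
    with f show "\<exists>f\<in>F. x \<otimes> inv f \<in> K \<inter> H" by blast
  qed (use F HC in auto)
qed

lemma almost_subset_finite:
  assumes "almost_subset G H K" "H \<subseteq> carrier G" "finite K"
  shows "finite H"
proof -
  obtain F where F: "finite F" "F \<subseteq> carrier G" "\<forall>x\<in>H. \<exists>f\<in>F. x \<otimes> inv f \<in> K"
    using assms(1) unfolding almost_subset_def by blast
  have "x \<in> (\<lambda>(k, f). k \<otimes> f) ` (K \<times> F)" if x: "x \<in> H" for x
  proof -
    obtain f where f: "f \<in> F" "x \<otimes> inv f \<in> K" using F(3) x by blast
    have "x = x \<otimes> inv f \<otimes> f"
      using x f(1) F(2) assms(2) by (simp add: subset_eq m_assoc)
    with f show ?thesis by force
  qed
  then show ?thesis using finite_subset[of H] F(1) assms(3) by blast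
qed

lemma finite_index_iff: "finite_index H G \<longleftrightarrow> subgroup H G \<and> almost_subset G (carrier G) H"
proof (cases "subgroup H G")
  case True
  then have "carrier G \<inter> H = H" using subgroup.subset by blast
  then show ?thesis using True finite_index_Int_iff[OF subgroup_self True] by simp
qed (simp add: finite_index_def)

lemma subgroup_nat_pow_closed:
  "subgroup H G \<Longrightarrow> x \<in> H \<Longrightarrow> x [^] (k::nat) \<in> H"
  by (induction k) (auto simp: subgroup.one_closed subgroup.m_closed)

lemma conjugate_nat_pow:
  assumes "u \<in> carrier G" "x \<in> carrier G"
  shows "(u \<otimes> x \<otimes> inv u) [^] (k::nat) = u \<otimes> x [^] k \<otimes> inv u"
proof (induction k)
  case 0
  show ?case using assms by simp
next
  case (Suc k)
  have "inv u \<otimes> (u \<otimes> y) = y" if "y \<in> carrier G" for y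
    using assms(1) that by (metis inv_closed l_one m_assoc l_inv)
  with Suc assms show ?case by (simp add: m_assoc)
qed

end

section \<open>Transport along homomorphisms and isomorphisms\<close>

lemma almost_subset_image:
  assumes "group G" "group G'" "h \<in> hom G G'" "H \<subseteq> carrier G" "almost_subset G H K"
  shows "almost_subset G' (h ` H) (h ` K)"
proof -
  interpret group_hom G G' h
    using assms by (simp add: group_hom_def group_hom_axioms_def)
  obtain F where F: "finite F" "F \<subseteq> carrier G" "\<forall>x\<in>H. \<exists>f\<in>F. x \<otimes>\<^bsub>G\<^esub> inv\<^bsub>G\<^esub> f \<in> K"
    using assms(5) unfolding almost_subset_def by blast
  have "\<exists>f\<in>h ` F. h x \<otimes>\<^bsub>G'\<^esub> inv\<^bsub>G'\<^esub> f \<in> h ` K" if x: "x \<in> H" for x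
  proof -
    obtain f where f: "f \<in> F" "x \<otimes>\<^bsub>G\<^esub> inv\<^bsub>G\<^esub> f \<in> K" using F(3) x by blast
    have "h (x \<otimes>\<^bsub>G\<^esub> inv\<^bsub>G\<^esub> f) = h x \<otimes>\<^bsub>G'\<^esub> inv\<^bsub>G'\<^esub> h f"
      using x f(1) F(2) assms(4) by (metis G.inv_closed hom_inv hom_mult subsetD)
    with f show ?thesis by (metis imageI)
  qed
  moreover have "h ` F \<subseteq> carrier G'" using F(2) by auto
  ultimately show ?thesis using F(1) unfolding almost_subset_def by blast
qed

lemma commensurated_image:
  assumes "group G" "group G'" "h \<in> iso G G'" "commensurated G H"
  shows "commensurated G' (h ` H)"
proof -
  have hom: "h \<in> hom G G'" and surj: "h ` carrier G = carrier G'"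
    using assms(3) by (auto simp: iso_def bij_betw_def)
  interpret group_hom G G' h
    using assms hom by (simp add: group_hom_def group_hom_axioms_def)
  have H: "subgroup H G" and
    al: "\<And>g. g \<in> carrier G \<Longrightarrow> almost_subset G ((\<lambda>x. g \<otimes>\<^bsub>G\<^esub> x \<otimes>\<^bsub>G\<^esub> inv\<^bsub>G\<^esub> g) ` H) H"
    using assms(4) G.commensurated_iff by auto
  have HC: "H \<subseteq> carrier G" by (rule subgroup.subset[OF H])
  have "almost_subset G' ((\<lambda>x. g' \<otimes>\<^bsub>G'\<^esub> x \<otimes>\<^bsub>G'\<^esub> inv\<^bsub>G'\<^esub> g') ` h ` H) (h ` H)"
    if g': "g' \<in> carrier G'" for g'
  proof -
    obtain g where g: "g \<in> carrier G" "g' = h g" using g' surj by blast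
    have "h ` (\<lambda>x. g \<otimes>\<^bsub>G\<^esub> x \<otimes>\<^bsub>G\<^esub> inv\<^bsub>G\<^esub> g) ` H = (\<lambda>x. g' \<otimes>\<^bsub>G'\<^esub> x \<otimes>\<^bsub>G'\<^esub> inv\<^bsub>G'\<^esub> g') ` h ` H"
      unfolding image_image
      by (rule image_cong) (use HC g in \<open>auto simp: subset_eq\<close>)
    moreover have "(\<lambda>x. g \<otimes>\<^bsub>G\<^esub> x \<otimes>\<^bsub>G\<^esub> inv\<^bsub>G\<^esub> g) ` H \<subseteq> carrier G" using HC g by auto
    ultimately show ?thesis
      using almost_subset_image[OF assms(1,2) hom _ al[OF g(1)]] by metis
  qed
  then show ?thesis using H.commensurated_iff subgroup_img_is_subgroup[OF H] by blast
qed

lemma commensurable_image: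
  assumes "group G" "group G'" "h \<in> hom G G'" "commensurable G H K"
  shows "commensurable G' (h ` H) (h ` K)"
proof -
  interpret group_hom G G' h
    using assms by (simp add: group_hom_def group_hom_axioms_def)
  have "H \<subseteq> carrier G" "K \<subseteq> carrier G"
    using assms(4) G.commensurable_iff subgroup.subset by blast+
  then show ?thesis
    using assms(4) subgroup_img_is_subgroup almost_subset_image[OF assms(1-3)]
    by (auto simp: G.commensurable_iff H.commensurable_iff)
qed

lemma inner_commensurator_normalizer_iso:
  assumes "group G" "group G'" "h \<in> iso G G'" "inner_commensurator_normalizer G"
  shows "inner_commensurator_normalizer G'"
  unfolding inner_commensurator_normalizer_def
proof (intro allI impI)
  fix H assume H: "commensurated G' H"
  let ?k = "inv_into (carrier G) h"
  have bij: "bij_betw h (carrier G) (carrier G')" and hom: "h \<in> hom G G'"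
    using assms(3) by (auto simp: iso_def)
  have HC: "H \<subseteq> carrier G'"
    using H by (auto simp: commensurated_def dest: subgroup.subset)
  have "commensurated G (?k ` H)"
    using commensurated_image[OF assms(2,1) group.iso_set_sym[OF assms(1,3)] H] .
  then obtain N where N: "N \<lhd> G" "commensurable G (?k ` H) N"
    using assms(4) unfolding inner_commensurator_normalizer_def by blast
  have "h ` ?k ` H = H"
    using bij HC by (auto simp: bij_betw_def image_inv_into_cancel)
  then have "commensurable G' H (h ` N)"
    using commensurable_image[OF assms(1,2) hom N(2)] by simp
  moreover have "h ` N \<lhd> G'"
  proof -
    interpret G': group G' by (rule assms(2))
    show ?thesis
      using normal.surj_hom_normal_subgroup[OF N(1), of G' h] bij hom assms(1,2)
      by (simp add: bij_betw_def group_hom_def group_hom_axioms_def)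
  qed
  ultimately show "\<exists>N. N \<lhd> G' \<and> commensurable G' H N" by blast
qed

text \<open>This carries the example, which is built on triples, over to a group whose elements are
  natural numbers.\<close>

lemma countable_group_iso_nat:
  fixes G :: "('a, 'b) monoid_scheme" (structure)
  assumes "group G" "countable (carrier G)"
  obtains G' :: "nat monoid" and h where "group G'" "h \<in> iso G G'"
proof -
  interpret group G by (rule assms(1))
  define h where "h = to_nat_on (carrier G)"
  define k where "k = inv_into (carrier G) h"
  have inj: "inj_on h (carrier G)" using assms(2) by (simp add: h_def inj_on_to_nat_on)
  then have kh: "\<And>x. x \<in> carrier G \<Longrightarrow> k (h x) = x" by (simp add: k_def)
  define G' where "G' = \<lparr>carrier = h ` carrier G, monoid.mult = (\<lambda>x y. h (k x \<otimes> k y)), one = h \<one>\<rparr>"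
  have "h \<in> iso G G'"
    using inj kh by (auto simp: iso_def hom_def bij_betw_def G'_def)
  moreover have "monoid G'"
    by (rule monoidI) (auto simp: G'_def kh m_assoc)
  ultimately show thesis
    using that iso_imp_group[of G'] is_isoI by blast
qed

subsection \<open>Almost invariant groups of finite sets of integers\<close>

text \<open>This abstracts the configurations contained in a commensurated subgroup. Symmetric
  difference is addition of finitely supported functions modulo 2, and conjugation by the unit shift
  or by the reflection preserves \<open>A\<close> up to an error inside one fixed interval.\<close>

locale almost_invariant =
  fixes A :: "int set set" and m :: int
  assumes m: "m \<ge> 0"
    and sym_diff: "S \<in> A \<Longrightarrow> T \<in> A \<Longrightarrow> sym_diff S T \<in> A"
    and finite: "S \<in> A \<Longrightarrow> finite S"
    and shift: "S \<in> A \<Longrightarrow> \<exists>T\<subseteq>{-m..m}. sym_diff {x. x - 1 \<in> S} T \<in> A"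
    and reflect: "S \<in> A \<Longrightarrow> \<exists>T\<subseteq>{-m..m}. sym_diff {x. - x \<in> S} T \<in> A"
begin

text \<open>Each further shift moves the accumulated error one step to the right and adds a new
  error near the origin, so the error interval grows only at its right end.\<close>

lemma shift_power:
  assumes "S \<in> A"
  shows "\<exists>T\<subseteq>{-m..m + int N}. sym_diff {x. x - int N \<in> S} T \<in> A"
proof (induction N)
  case 0
  show ?case using assms by (intro exI[of _ "{}"]) auto
next
  case (Suc N)
  then obtain T where T: "T \<subseteq> {-m..m + int N}" "sym_diff {x. x - int N \<in> S} T \<in> A" by blast
  obtain U where U: "U \<subseteq> {-m..m}"
    "sym_diff {x. x - 1 \<in> sym_diff {x. x - int N \<in> S} T} U \<in> A" using shift[OF T(2)] by blast
  have "sym_diff {x. x - 1 \<in> sym_diff {x. x - int N \<in> S} T} U =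
      sym_diff {x. x - int (Suc N) \<in> S} (sym_diff {x. x - 1 \<in> T} U)"
    by (auto simp: algebra_simps)
  moreover have "sym_diff {x. x - 1 \<in> T} U \<subseteq> {-m..m + int (Suc N)}"
    using T(1) U(1) by (auto simp: subset_eq; smt (verit))
  ultimately show ?case using U(2) by metis
qed

text \<open>Shifting an element that reaches beyond \<open>m\<close> far to the right loses its left half
  inside the error interval, but keeps its top entry.\<close>

lemma right_supported:
  assumes "S \<in> A" "x \<in> S" "x > m"
  obtains P j where "P \<in> A" "P \<subseteq> {-m..j}" "j \<in> P" "j > m"
proof -
  \<comment> \<open>A shift by this amount moves all of \<open>S\<close> into the nonnegative
    integers.\<close>
  define N where "N = nat (- Min S)"
  have fin: "finite S" using finite assms(1) by blast
  have "Max S \<in> S" using fin assms(2) by (intro Max_in) auto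
  moreover have le: "\<And>y. y \<in> S \<Longrightarrow> y \<le> Max S" by (rule Max_ge[OF fin])
  moreover have "Max S > m" using le[OF assms(2)] assms(3) by simp
  ultimately have Max: "Max S \<in> S" "Max S > m" "\<And>y. y \<in> S \<Longrightarrow> y \<le> Max S" by blast+
  have Min: "y + int N \<ge> 0" if "y \<in> S" for y
    using Min_le[OF fin that] by (simp add: N_def)
  obtain T where T: "T \<subseteq> {-m..m + int N}" "sym_diff {x. x - int N \<in> S} T \<in> A"
    using shift_power[OF assms(1)] by blast
  show thesis
  proof
    show "sym_diff {x. x - int N \<in> S} T \<in> A" by (rule T(2))
    show "sym_diff {x. x - int N \<in> S} T \<subseteq> {-m..Max S + int N}"
      using T(1) Min Max(2,3) m by (auto simp: subset_eq; smt (verit))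
    \<comment> \<open>The error stops at \<open>m + int N\<close>, strictly below the shifted
      maximum, and cannot cancel it.\<close>
    show "Max S + int N \<in> sym_diff {x. x - int N \<in> S} T"
      using T(1) Max(1,2) by auto
    show "Max S + int N > m" using Max(2) by simp
  qed
qed

text \<open>Shifts of \<open>P\<close> provide elements of \<open>A\<close> with every prescribed
  top entry from \<open>j\<close> on. Elimination from the top then reduces each finite set in
  \<open>{-m..}\<close> to one below \<open>j\<close>. Negative entries are reflected, reduced in
  the same way and reflected back.\<close>

lemma almost_full:
  assumes "S \<in> A" "x \<in> S" "x > m"
  obtains j where "\<And>S. finite S \<Longrightarrow> \<exists>T\<subseteq>{-j..j}. sym_diff S T \<in> A"
proof -
  obtain P j where P: "P \<in> A" "P \<subseteq> {-m..j}" "j \<in> P" "j > m"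
    using right_supported[OF assms] by blast
  have empty_in: "{} \<in> A" using sym_diff[OF P(1) P(1)] by simp
  have top: "\<exists>Q\<in>A. Q \<subseteq> {-m..j + int k} \<and> j + int k \<in> Q" for k
  proof -
    obtain T where T: "T \<subseteq> {-m..m + int k}" "sym_diff {x. x - int k \<in> P} T \<in> A"
      using shift_power[OF P(1)] by blast
    have "sym_diff {x. x - int k \<in> P} T \<subseteq> {-m..j + int k}"
      using T(1) P(2,4) by (auto simp: subset_eq; smt (verit))
    moreover have "j + int k \<in> sym_diff {x. x - int k \<in> P} T"
      using T(1) P(3,4) by auto
    ultimately show ?thesis using T(2) by blast
  qed
  \<comment> \<open>The induction clears the top position \<open>j + int k\<close>: if it is lit,
    adding \<open>Q\<close> switches it off and changes only positions below it that are still at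
    least \<open>-m\<close>.\<close>
  have right: "S \<subseteq> {-m..<j + int k} \<Longrightarrow> \<exists>T\<subseteq>{-m..<j}. sym_diff S T \<in> A" for S k
  proof (induction k arbitrary: S)
    case 0
    then show ?case using empty_in by (intro exI[of _ S]) auto
  next
    case (Suc k)
    show ?case
    proof (cases "j + int k \<in> S")
      case False
      then have "S \<subseteq> {-m..<j + int k}" using Suc.prems by (auto simp: subset_eq; smt (verit))
      then show ?thesis by (rule Suc.IH)
    next
      case True
      obtain Q where Q: "Q \<in> A" "Q \<subseteq> {-m..j + int k}" "j + int k \<in> Q" using top by blast
      have "sym_diff S Q \<subseteq> {-m..<j + int k}"
        using Suc.prems Q(2,3) True by (auto simp: subset_eq; smt (verit))
      then obtain T where T: "T \<subseteq> {-m..<j}" "sym_diff (sym_diff S Q) T \<in> A"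
        using Suc.IH by blast
      have "sym_diff (sym_diff (sym_diff S Q) T) Q = sym_diff S T" by blast
      with T sym_diff[OF T(2) Q(1)] show ?thesis by metis
    qed
  qed
  have nonneg: "\<exists>T\<subseteq>{-m..<j}. sym_diff S T \<in> A" if S: "finite S" "S \<subseteq> {-m..}" for S
  proof -
    obtain b where b: "\<And>y. y \<in> S \<Longrightarrow> y < b"
      using S(1) by (metis Max_ge add1_zle_eq zle_add1_eq_le)
    have "S \<subseteq> {-m..<j + int (nat (b - j))}" using S(2) b by (auto simp: subset_eq; smt (verit))
    then show ?thesis by (rule right)
  qed
  show thesis
  proof
    fix S :: "int set" assume S: "finite S"
    obtain T where T: "T \<subseteq> {-m..<j}" "sym_diff (S \<inter> {0..}) T \<in> A"
      using nonneg[of "S \<inter> {0..}"] S m by (auto simp: subset_eq)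
    have "finite {x. - x \<in> S \<inter> {..<0}}"
      using finite_vimageI[of "S \<inter> {..<0}" uminus] S by (simp add: vimage_def)
    then obtain U where U: "U \<subseteq> {-m..<j}" "sym_diff {x. - x \<in> S \<inter> {..<0}} U \<in> A"
      using nonneg[of "{x. - x \<in> S \<inter> {..<0}}"] m by (auto simp: subset_eq)
    obtain R where R: "R \<subseteq> {-m..m}"
      "sym_diff {x. - x \<in> sym_diff {x. - x \<in> S \<inter> {..<0}} U} R \<in> A"
      using reflect[OF U(2)] by blast
    \<comment> \<open>\<open>W\<close> collects the remainders of both halves and the error of the
      reflection; all of them stay within \<open>{-j..j}\<close> because
      \<open>m < j\<close>.\<close>
    define W where "W = sym_diff T (sym_diff {x. - x \<in> U} R)"
    have "sym_diff (sym_diff (S \<inter> {0..}) T)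
        (sym_diff {x. - x \<in> sym_diff {x. - x \<in> S \<inter> {..<0}} U} R) = sym_diff S W"
      unfolding W_def by auto
    moreover have "W \<subseteq> {-j..j}"
      using T(1) U(1) R(1) P(4) unfolding W_def by (auto simp: subset_eq; smt (verit))
    ultimately show "\<exists>T\<subseteq>{-j..j}. sym_diff S T \<in> A"
      using sym_diff[OF T(2) R(2)] by metis
  qed
qed

end

subsection \<open>The dihedral lamplighter group\<close>

text \<open>The triple \<open>(S, e, n)\<close> stands for the configuration \<open>S\<close> together with the isometry
  \<open>x \<mapsto> e x + n\<close>. Since \<open>e = \<plusminus>1\<close>, the image of \<open>S\<close> under it can be written as a preimage.\<close>

definition dihedral_act :: "int \<Rightarrow> int \<Rightarrow> int set \<Rightarrow> int set" where
  "dihedral_act e n S = {x. e * (x - n) \<in> S}"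

definition dihedral_lamp :: "(int set \<times> int \<times> int) monoid" where
  "dihedral_lamp =
     \<lparr>carrier = {(S, e, n). finite S \<and> (e = 1 \<or> e = -1)},
      monoid.mult = (\<lambda>(S, e, n) (T, d, k). (sym_diff S (dihedral_act e n T), e * d, n + e * k)),
      one = ({}, 1, 0)\<rparr>"

lemma dihedral_act_simps:
  "x \<in> dihedral_act e n S \<longleftrightarrow> e * (x - n) \<in> S"
  by (simp add: dihedral_act_def)

lemma dihedral_act_empty [simp]: "dihedral_act e n {} = {}"
  by (simp add: dihedral_act_def)

lemma dihedral_act_id [simp]: "dihedral_act 1 0 S = S"
  by (simp add: dihedral_act_def)

lemma carrier_dihedral_lamp [simp]:
  "(S, e, n) \<in> carrier dihedral_lamp \<longleftrightarrow> finite S \<and> (e = 1 \<or> e = -1)"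
  by (simp add: dihedral_lamp_def)

lemma mult_dihedral_lamp [simp]:
  "(S, e, n) \<otimes>\<^bsub>dihedral_lamp\<^esub> (T, d, k) = (sym_diff S (dihedral_act e n T), e * d, n + e * k)"
  by (simp add: dihedral_lamp_def)

lemma one_dihedral_lamp [simp]: "\<one>\<^bsub>dihedral_lamp\<^esub> = ({}, 1, 0)"
  by (simp add: dihedral_lamp_def)

lemma finite_dihedral_act:
  assumes "finite S" "e = 1 \<or> e = -1"
  shows "finite (dihedral_act e n S)"
proof -
  have "dihedral_act e n S = (\<lambda>x. e * (x - n)) -` S" by (auto simp: dihedral_act_def)
  moreover have "inj (\<lambda>x. e * (x - n))" using assms(2) by (auto simp: inj_def)
  ultimately show ?thesis using assms(1) by (simp add: finite_vimageI)
qed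

lemma dihedral_act_sym_diff:
  "dihedral_act e n (sym_diff S T) = sym_diff (dihedral_act e n S) (dihedral_act e n T)"
  by (auto simp: dihedral_act_def)

text \<open>This is the composition law of the isometries \<open>x \<mapsto> e x + n\<close> and
  \<open>x \<mapsto> d x + k\<close>; in the preimage form it comes down to
  \<open>e * e = 1\<close>.\<close>

lemma dihedral_act_act:
  assumes "e = 1 \<or> e = -1"
  shows "dihedral_act e n (dihedral_act d k S) = dihedral_act (e * d) (n + e * k) S"
proof -
  have "d * (e * (x - n) - k) = e * d * (x - (n + e * k))" for x
    using assms by (auto simp: algebra_simps)
  then show ?thesis by (simp only: dihedral_act_def mem_Collect_eq)
qed

lemma group_dihedral_lamp: "group dihedral_lamp"
proof (rule groupI)
  fix x y assume xy: "x \<in> carrier dihedral_lamp" "y \<in> carrier dihedral_lamp"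
  obtain S e n where eqx: "x = (S, e, n)" by (rule prod_cases3)
  obtain T d k where eqy: "y = (T, d, k)" by (rule prod_cases3)
  note eq = eqx eqy
  have "finite (sym_diff S (dihedral_act e n T))"
    using xy by (simp add: eq finite_dihedral_act)
  moreover have "e = 1 \<or> e = -1" "d = 1 \<or> d = -1" using xy by (simp_all add: eq)
  then have "e * d = 1 \<or> e * d = -1" by (elim disjE; simp)
  ultimately show "x \<otimes>\<^bsub>dihedral_lamp\<^esub> y \<in> carrier dihedral_lamp" by (simp add: eq)
next
  fix x y z :: "int set \<times> int \<times> int"
  assume x: "x \<in> carrier dihedral_lamp"
  obtain S e n where eqx: "x = (S, e, n)" by (rule prod_cases3)
  obtain T d k where eqy: "y = (T, d, k)" by (rule prod_cases3)
  obtain U c l where eqz: "z = (U, c, l)" by (rule prod_cases3)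
  note eq = eqx eqy eqz
  have e: "e = 1 \<or> e = -1" using x by (simp add: eq)
  have "sym_diff (sym_diff S A) B = sym_diff S (sym_diff A B)" for A B by blast
  then show "x \<otimes>\<^bsub>dihedral_lamp\<^esub> y \<otimes>\<^bsub>dihedral_lamp\<^esub> z = x \<otimes>\<^bsub>dihedral_lamp\<^esub> (y \<otimes>\<^bsub>dihedral_lamp\<^esub> z)"
    by (simp only: eq mult_dihedral_lamp dihedral_act_sym_diff dihedral_act_act[OF e]
        mult.assoc distrib_left add.assoc)
next
  fix x assume "x \<in> carrier dihedral_lamp"
  then obtain S e n where x: "x = (S, e, n)" "finite S" "e = 1 \<or> e = -1"
    by (cases x) auto
  show "\<one>\<^bsub>dihedral_lamp\<^esub> \<otimes>\<^bsub>dihedral_lamp\<^esub> x = x"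
    using x by (simp add: dihedral_act_def)
  \<comment> \<open>Since \<open>e\<close> is its own inverse, the inverse isometry is
    \<open>x \<mapsto> e x - e n\<close>, and \<open>S\<close> has to be moved by it.\<close>
  have "(dihedral_act e (- e * n) S, e, - e * n) \<otimes>\<^bsub>dihedral_lamp\<^esub> x = \<one>\<^bsub>dihedral_lamp\<^esub>"
    using x by (auto simp: dihedral_act_simps)
  moreover have "(dihedral_act e (- e * n) S, e, - e * n) \<in> carrier dihedral_lamp"
    using x by (auto simp: finite_dihedral_act)
  ultimately show "\<exists>y\<in>carrier dihedral_lamp. y \<otimes>\<^bsub>dihedral_lamp\<^esub> x = \<one>\<^bsub>dihedral_lamp\<^esub>"
    by blast
qed simp

interpretation dihedral_lamp: group dihedral_lamp
  by (rule group_dihedral_lamp)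

lemma inv_dihedral_lamp [simp]:
  assumes "finite S" "e = 1 \<or> e = -1"
  shows "inv\<^bsub>dihedral_lamp\<^esub> (S, e, n) = (dihedral_act e (- e * n) S, e, - e * n)"
proof (rule dihedral_lamp.inv_equality)
  have "e * e = 1" using assms(2) by auto
  then show "(dihedral_act e (- e * n) S, e, - e * n) \<otimes>\<^bsub>dihedral_lamp\<^esub> (S, e, n) = \<one>\<^bsub>dihedral_lamp\<^esub>"
    by simp
qed (use assms in \<open>simp_all add: finite_dihedral_act\<close>)

lemma countable_dihedral_lamp: "countable (carrier dihedral_lamp)"
proof (rule countable_subset)
  show "carrier dihedral_lamp \<subseteq> {S. finite S} \<times> UNIV" by (auto simp: dihedral_lamp_def)
  show "countable ({S :: int set. finite S} \<times> (UNIV :: (int \<times> int) set))"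
    by (intro countable_SIGMA countable_Collect_finite) auto
qed

definition lamps :: "(int set \<times> int \<times> int) set" where
  "lamps = {(S, e, n). finite S \<and> e = 1 \<and> n = 0}"

lemma in_lamps [simp]: "(S, e, n) \<in> lamps \<longleftrightarrow> finite S \<and> e = 1 \<and> n = 0"
  by (simp add: lamps_def)

text \<open>These are the elements with trivial isometry, that is, the kernel of the projection to
  the dihedral group.\<close>

lemma normal_lamps: "lamps \<lhd> dihedral_lamp"
  unfolding dihedral_lamp.normal_inv_iff
proof (intro conjI ballI)
  show "subgroup lamps dihedral_lamp"
  proof (rule dihedral_lamp.subgroupI)
    fix x y assume "x \<in> lamps" "y \<in> lamps"
    then obtain S T where "x = (S, 1, 0)" "finite S" "y = (T, 1, 0)" "finite T"
      by (auto simp: lamps_def)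
    then show "inv\<^bsub>dihedral_lamp\<^esub> x \<in> lamps" "x \<otimes>\<^bsub>dihedral_lamp\<^esub> y \<in> lamps"
      by (simp_all add: finite_dihedral_act)
  qed (auto simp: lamps_def)
  fix x h assume x: "x \<in> carrier dihedral_lamp" and "h \<in> lamps"
  then obtain S e n T where eq: "x = (S, e, n)" "h = (T, 1, 0)" "finite T"
    by (cases x) (auto simp: lamps_def)
  have e: "finite S" "e = 1 \<or> e = -1" using x by (simp_all add: eq)
  then have "e * e = 1" by auto
  then show "x \<otimes>\<^bsub>dihedral_lamp\<^esub> h \<otimes>\<^bsub>dihedral_lamp\<^esub> inv\<^bsub>dihedral_lamp\<^esub> x \<in> lamps"
    using e eq(3) by (simp add: eq finite_dihedral_act)
qed

section \<open>Commensurated subgroups of the dihedral lamplighter group\<close>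

lemma bounded_int_set:
  fixes U :: "int set"
  assumes "finite U"
  obtains m where "m \<ge> 0" "U \<subseteq> {-m..m}"
proof
  have "\<bar>x\<bar> \<le> Max (insert 0 (abs ` U))" if "x \<in> U" for x
    using assms that by (intro Max_ge) auto
  then show "U \<subseteq> {- Max (insert 0 (abs ` U))..Max (insert 0 (abs ` U))}"
    by (auto simp: abs_le_iff) (smt (verit))
  show "Max (insert 0 (abs ` U)) \<ge> 0" using assms by (intro Max_ge) auto
qed

text \<open>Conjugation by the pure isometry \<open>({}, e, n)\<close> acts on configurations as
  \<open>dihedral_act e n\<close>. The errors are finitely many coset representatives, and these are
  finite configurations, so a single interval contains them all.\<close>

lemma commensurated_lamps_almost_invariant:
  assumes H: "commensurated dihedral_lamp H" and e: "e = 1 \<or> e = -1"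
  obtains m where "m \<ge> 0"
    "\<And>S. (S, 1, 0) \<in> H \<Longrightarrow>
       \<exists>T\<subseteq>{-m..m}. (sym_diff (dihedral_act e n S) T, 1, 0) \<in> H"
proof -
  let ?G = dihedral_lamp
  define g where "g = ({} :: int set, e, n)"
  have g: "g \<in> carrier ?G" using e by (simp add: g_def)
  have "e * e = 1" using e by auto
  have sub: "subgroup H ?G" and
    al: "almost_subset ?G ((\<lambda>x. g \<otimes>\<^bsub>?G\<^esub> x \<otimes>\<^bsub>?G\<^esub> inv\<^bsub>?G\<^esub> g) ` H) H"
    using H g by (auto simp: dihedral_lamp.commensurated_iff)
  have HC: "H \<subseteq> carrier ?G" by (rule subgroup.subset[OF sub])
  \<comment> \<open>Only the conjugates of configurations in \<open>H\<close> are kept.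
    Representatives chosen inside \<open>C\<close> are then configurations themselves, rather than
    arbitrary group elements.\<close>
  define C where "C = {(dihedral_act e n S, 1 :: int, 0 :: int) | S. (S, 1, 0) \<in> H}"
  have "(dihedral_act e n S, 1, 0) \<in> (\<lambda>x. g \<otimes>\<^bsub>?G\<^esub> x \<otimes>\<^bsub>?G\<^esub> inv\<^bsub>?G\<^esub> g) ` H"
    if S: "(S, 1, 0) \<in> H" for S
  proof (rule image_eqI[OF _ S])
    show "(dihedral_act e n S, 1, 0) = g \<otimes>\<^bsub>?G\<^esub> (S, 1, 0) \<otimes>\<^bsub>?G\<^esub> inv\<^bsub>?G\<^esub> g"
      using e \<open>e * e = 1\<close> by (simp add: g_def)
  qed
  then have "C \<subseteq> (\<lambda>x. g \<otimes>\<^bsub>?G\<^esub> x \<otimes>\<^bsub>?G\<^esub> inv\<^bsub>?G\<^esub> g) ` H"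
    unfolding C_def by blast
  then have "almost_subset ?G C H" using al almost_subset_mono by blast
  moreover have XL: "C \<subseteq> lamps"
  proof
    fix x assume "x \<in> C"
    then obtain S where S: "x = (dihedral_act e n S, 1, 0)" "(S, 1, 0) \<in> H"
      unfolding C_def by blast
    then have "finite S" using HC by auto
    then show "x \<in> lamps" by (simp add: S(1) finite_dihedral_act e)
  qed
  moreover have "lamps \<subseteq> carrier ?G"
    by (auto simp: lamps_def)
  ultimately obtain F where F: "finite F" "F \<subseteq> C"
    "\<And>x. x \<in> C \<Longrightarrow> \<exists>f\<in>F. x \<otimes>\<^bsub>?G\<^esub> inv\<^bsub>?G\<^esub> f \<in> H"
    using dihedral_lamp.almost_subset_reps[OF _ sub] by (metis order_trans)
  have FL: "F \<subseteq> lamps" using F(2) XL by blast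
  have "finite (\<Union>(fst ` F))" using F(1) FL by (auto simp: lamps_def)
  then obtain m where m: "m \<ge> 0" "\<Union>(fst ` F) \<subseteq> {-m..m}" using bounded_int_set by blast
  show thesis
  proof
    show "m \<ge> 0" by (rule m(1))
    fix S assume "(S, 1, 0) \<in> H"
    then obtain f where f: "f \<in> F" "(dihedral_act e n S, 1, 0) \<otimes>\<^bsub>?G\<^esub> inv\<^bsub>?G\<^esub> f \<in> H"
      using F(3) unfolding C_def by blast
    obtain T where T: "f = (T, 1, 0)" "finite T" using f(1) FL by (auto simp: lamps_def)
    have "(sym_diff (dihedral_act e n S) T, 1, 0) \<in> H"
      using f(2) T by (simp add: dihedral_act_def)
    moreover have "T \<subseteq> {-m..m}" using m(2) f(1) T(1) by force
    ultimately show "\<exists>T\<subseteq>{-m..m}. (sym_diff (dihedral_act e n S) T, 1, 0) \<in> H" by blast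
  qed
qed

text \<open>Infinitely many sets cannot all be contained in one finite interval. Hence some
  configuration of \<open>H\<close> reaches beyond the error interval, on the right after a
  reflection if necessary, and \<open>almost_full\<close> applies.\<close>

lemma infinite_lamps_almost_full:
  assumes H: "commensurated dihedral_lamp H" and inf: "infinite {S. (S, 1, 0) \<in> H}"
  shows "almost_subset dihedral_lamp lamps H"
proof -
  let ?G = dihedral_lamp
  let ?A = "{S. (S, 1, 0) \<in> H}"
  have sub: "subgroup H ?G" using H by (simp add: commensurated_def)
  have HC: "H \<subseteq> carrier ?G" by (rule subgroup.subset[OF sub])
  obtain m1 where m1: "m1 \<ge> 0"
    "\<And>S. (S, 1, 0) \<in> H \<Longrightarrow> \<exists>T\<subseteq>{-m1..m1}. (sym_diff (dihedral_act 1 1 S) T, 1, 0) \<in> H"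
    using commensurated_lamps_almost_invariant[OF H] by (metis (no_types, lifting))
  obtain m2 where m2: "m2 \<ge> 0"
    "\<And>S. (S, 1, 0) \<in> H \<Longrightarrow> \<exists>T\<subseteq>{-m2..m2}. (sym_diff (dihedral_act (-1) 0 S) T, 1, 0) \<in> H"
    using commensurated_lamps_almost_invariant[OF H] by (metis (no_types, lifting))
  define m where "m = max m1 m2"
  have le: "{-m1..m1} \<subseteq> {-m..m}" "{-m2..m2} \<subseteq> {-m..m}" by (auto simp: m_def)
  interpret almost_invariant ?A m
  proof
    show "m \<ge> 0" using m1(1) by (simp add: m_def)
    fix S assume S: "S \<in> ?A"
    then show fin: "finite S" using HC by auto
    show "\<exists>T\<subseteq>{-m..m}. sym_diff {x. x - 1 \<in> S} T \<in> ?A"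
      using m1(2)[of S] S order_trans[OF _ le(1)] by (auto simp: dihedral_act_def)
    show "\<exists>T\<subseteq>{-m..m}. sym_diff {x. - x \<in> S} T \<in> ?A"
      using m2(2)[of S] S order_trans[OF _ le(2)] by (auto simp: dihedral_act_def)
    fix T assume "T \<in> ?A"
    then have "(S, 1, 0) \<otimes>\<^bsub>?G\<^esub> (T, 1, 0) \<in> H"
      using S subgroup.m_closed[OF sub] by blast
    then show "sym_diff S T \<in> ?A" by (simp add: dihedral_act_def)
  qed
  have "\<not> ?A \<subseteq> Pow {-m..m}" using inf finite_subset by blast
  then obtain S x where S: "S \<in> ?A" "x \<in> S" "x \<notin> {-m..m}" by blast
  obtain R y where R: "R \<in> ?A" "y \<in> R" "y > m"
  proof (cases "x > m")
    case False
    obtain T where T: "T \<subseteq> {-m..m}" "sym_diff {x. - x \<in> S} T \<in> ?A"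
      using reflect[OF S(1)] by blast
    \<comment> \<open>The entry \<open>x\<close> lies to the left of \<open>-m\<close>; its mirror
      image is outside the error interval and survives.\<close>
    have "- x \<in> sym_diff {x. - x \<in> S} T" using S(2,3) T(1) by auto
    moreover have "- x > m" using S(3) False by auto
    ultimately show thesis using that T(2) by blast
  qed (use S that in blast)
  obtain j where j: "\<And>S. finite S \<Longrightarrow> \<exists>T\<subseteq>{-j..j}. sym_diff S T \<in> ?A"
    using almost_full[OF R] by blast
  \<comment> \<open>The finitely many possible remainders inside \<open>{-j..j}\<close> serve as the
    translating elements.\<close>
  let ?F = "(\<lambda>T. (T, 1, 0)) ` Pow {-j..j}"
  have "\<exists>f\<in>?F. x \<otimes>\<^bsub>?G\<^esub> inv\<^bsub>?G\<^esub> f \<in> H" if x: "x \<in> lamps" for x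
  proof -
    obtain S where S: "x = (S, 1, 0)" "finite S" using x by (auto simp: lamps_def)
    obtain T where T: "T \<subseteq> {-j..j}" "sym_diff S T \<in> ?A" using j[OF S(2)] by blast
    have "finite T" using T(1) finite_subset by blast
    then have "x \<otimes>\<^bsub>?G\<^esub> inv\<^bsub>?G\<^esub> (T, 1, 0) \<in> H" using T(2) S by (simp add: dihedral_act_def)
    with T(1) show ?thesis by blast
  qed
  moreover have "finite ?F" "?F \<subseteq> carrier ?G"
    using finite_subset[OF _ finite_atLeastAtMost_int] by auto
  ultimately show ?thesis by (rule almost_subsetI)
qed

lemma translation_nat_pow:
  "\<exists>T. (S, 1, n) [^]\<^bsub>dihedral_lamp\<^esub> (k::nat) = (T, 1, int k * n)"
proof (induction k)
  case (Suc k)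
  then obtain T where "(S, 1, n) [^]\<^bsub>dihedral_lamp\<^esub> k = (T, 1, int k * n)" by blast
  then show ?case by (simp add: nat_pow_def algebra_simps)
qed (simp add: nat_pow_def)

lemma translation_powers:
  assumes "subgroup H dihedral_lamp" "(S, 1, n) \<in> H"
  shows "\<exists>T. (T, 1, q * n) \<in> H"
proof -
  have nat: "\<exists>T. (T, 1, int k * n) \<in> H" for k
    using translation_nat_pow[of S n k] dihedral_lamp.subgroup_nat_pow_closed assms by metis
  show ?thesis
  proof (cases "q \<ge> 0")
    case True
    then show ?thesis using nat[of "nat q"] by simp
  next
    case False
    obtain T where T: "(T, 1, int (nat (- q)) * n) \<in> H" using nat by blast
    then have "finite T" using subgroup.subset[OF assms(1)] by auto
    then show ?thesis
      using subgroup.m_inv_closed[OF assms(1) T] False by auto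
  qed
qed

text \<open>For a single lamp \<open>u\<close> at \<open>x\<close>, the commutator of
  \<open>u\<close> with a suitable positive power of the given element lies in \<open>H\<close> and
  is a configuration that lights \<open>x\<close>. Thus the configurations in \<open>H\<close> cover
  all integers, which finitely many finite sets cannot do.\<close>

lemma translation_imp_infinite_lamps:
  assumes H: "commensurated dihedral_lamp H" and h: "(S, 1, n) \<in> H" "n \<noteq> 0"
  shows "infinite {S. (S, 1, 0) \<in> H}"
proof
  let ?G = dihedral_lamp
  have sub: "subgroup H ?G" using H by (simp add: commensurated_def)
  have HC: "H \<subseteq> carrier ?G" by (rule subgroup.subset[OF sub])
  have S: "finite S" using h(1) HC by auto
  assume fin: "finite {S. (S, 1, 0) \<in> H}"
  have "x \<in> \<Union>{S. (S, 1, 0) \<in> H}" for x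
  proof -
    define u where "u = ({x}, 1 :: int, 0 :: int)"
    have u: "u \<in> carrier ?G" by (simp add: u_def)
    let ?X = "(\<lambda>y. u \<otimes>\<^bsub>?G\<^esub> y \<otimes>\<^bsub>?G\<^esub> inv\<^bsub>?G\<^esub> u) ` H"
    have hC: "(S, 1, n) \<in> carrier ?G" using S by simp
    have pow: "(u \<otimes>\<^bsub>?G\<^esub> (S, 1, n) \<otimes>\<^bsub>?G\<^esub> inv\<^bsub>?G\<^esub> u) [^]\<^bsub>?G\<^esub> k \<in> ?X" for k :: nat
      unfolding dihedral_lamp.conjugate_nat_pow[OF u hC]
      using dihedral_lamp.subgroup_nat_pow_closed[OF sub h(1)] by blast
    have al: "almost_subset ?G ?X H" using H u by (simp add: dihedral_lamp.commensurated_iff)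
    have "u \<otimes>\<^bsub>?G\<^esub> (S, 1, n) \<otimes>\<^bsub>?G\<^esub> inv\<^bsub>?G\<^esub> u \<in> carrier ?G"
      using u hC by (intro dihedral_lamp.m_closed dihedral_lamp.inv_closed)
    \<comment> \<open>All powers of the conjugated element lie in the conjugate of \<open>H\<close>,
      which is almost contained in \<open>H\<close>; so some positive power lies in
      \<open>H\<close>.\<close>
    then obtain k :: nat where k: "k > 0"
      "(u \<otimes>\<^bsub>?G\<^esub> (S, 1, n) \<otimes>\<^bsub>?G\<^esub> inv\<^bsub>?G\<^esub> u) [^]\<^bsub>?G\<^esub> k \<in> H"
      using dihedral_lamp.almost_subset_pow[OF al sub _ pow] by blast
    obtain T where T: "(S, 1, n) [^]\<^bsub>?G\<^esub> k = (T, 1, int k * n)"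
      using translation_nat_pow by blast
    have TH: "(T, 1, int k * n) \<in> H"
      using dihedral_lamp.subgroup_nat_pow_closed[OF sub h(1), of k] T by simp
    then have "finite T" using HC by auto
    have "u \<otimes>\<^bsub>?G\<^esub> (T, 1, int k * n) \<otimes>\<^bsub>?G\<^esub> inv\<^bsub>?G\<^esub> u \<otimes>\<^bsub>?G\<^esub> inv\<^bsub>?G\<^esub> (T, 1, int k * n) \<in> H"
      using k(2) unfolding dihedral_lamp.conjugate_nat_pow[OF u hC] T
      by (rule subgroup.m_closed[OF sub _ subgroup.m_inv_closed[OF sub TH]])
    moreover have "u \<otimes>\<^bsub>?G\<^esub> (T, 1, int k * n) \<otimes>\<^bsub>?G\<^esub> inv\<^bsub>?G\<^esub> u \<otimes>\<^bsub>?G\<^esub> inv\<^bsub>?G\<^esub> (T, 1, int k * n) =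
        (sym_diff {x} {x + int k * n}, 1, 0)"
    proof -
      have "dihedral_act 1 (int k * n) {x} = {x + int k * n}"
        by (auto simp: dihedral_act_simps)
      \<comment> \<open>The unknown configuration \<open>T\<close> of the power occurs twice and
        cancels; only the lamp and its shifted copy remain.\<close>
      moreover have "sym_diff (sym_diff (sym_diff {x} T) B) T = sym_diff {x} B" for B by blast
      ultimately show ?thesis using \<open>finite T\<close> by (simp add: u_def dihedral_act_act)
    qed
    moreover have "x \<in> sym_diff {x} {x + int k * n}" using k(1) h(2) by simp
    ultimately show ?thesis by auto
  qed
  then have "\<Union>{S. (S, 1, 0) \<in> H} = UNIV" by blast
  moreover have "finite T" if "(T, 1, 0) \<in> H" for T using subsetD[OF HC that] by simp
  then have "finite (\<Union>{S. (S, 1, 0) \<in> H})" by (intro finite_Union[OF fin]) simp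
  ultimately show False using infinite_UNIV_int by simp
qed

text \<open>A left factor from \<open>H\<close> reduces the translation part of \<open>g\<close>
  modulo \<open>n\<close>. What is left is a configuration times one of finitely many pure
  isometries, and the configurations are already covered by finitely many translates of
  \<open>H\<close>.\<close>

lemma translation_imp_almost_full:
  assumes H: "commensurated dihedral_lamp H" and h: "(S, 1, n) \<in> H" "n \<noteq> 0"
  shows "almost_subset dihedral_lamp (carrier dihedral_lamp) H"
proof -
  let ?G = dihedral_lamp
  have sub: "subgroup H ?G" using H by (simp add: commensurated_def)
  have HC: "H \<subseteq> carrier ?G" by (rule subgroup.subset[OF sub])
  have "almost_subset ?G lamps H"
    using infinite_lamps_almost_full[OF H] translation_imp_infinite_lamps[OF H h] by blast
  then obtain F where F: "finite F" "F \<subseteq> carrier ?G"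
    "\<forall>x\<in>lamps. \<exists>f\<in>F. x \<otimes>\<^bsub>?G\<^esub> inv\<^bsub>?G\<^esub> f \<in> H"
    unfolding almost_subset_def by blast
  \<comment> \<open>The interval is symmetric because \<open>n\<close> may be negative, and
    \<open>r mod n\<close> takes the sign of \<open>n\<close>.\<close>
  let ?D = "{{}} \<times> {1, -1} \<times> {-\<bar>n\<bar>..\<bar>n\<bar>}"
  let ?E = "(\<lambda>(f, d). f \<otimes>\<^bsub>?G\<^esub> d) ` (F \<times> ?D)"
  have "\<exists>f\<in>?E. g \<otimes>\<^bsub>?G\<^esub> inv\<^bsub>?G\<^esub> f \<in> H" if gC: "g \<in> carrier ?G" for g
  proof -
    obtain R e r where g: "g = (R, e, r)" "finite R" "e = 1 \<or> e = -1" using gC by (cases g) auto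
    obtain T where T: "(T, 1, - (r div n) * n) \<in> H"
      using translation_powers[OF sub h(1)] by blast
    define t where "t = (T, 1 :: int, - (r div n) * n)"
    have t: "t \<in> H" "t \<in> carrier ?G" "finite T" using T HC by (auto simp: t_def)
    define d where "d = ({} :: int set, e, r mod n)"
    \<comment> \<open>\<open>v\<close> and \<open>d\<close> are the configuration and the isometry
      of the product of \<open>t\<close> and \<open>g\<close>, whose translation part is
      \<open>r mod n\<close>.\<close>
    define v where "v = (sym_diff T (dihedral_act 1 (- (r div n) * n) R), 1 :: int, 0 :: int)"
    have d: "d \<in> ?D"
      using g(3) h(2) abs_mod_less[of n r] by (auto simp: d_def)
    have dC: "d \<in> carrier ?G" using g(3) by (simp add: d_def)
    have v: "v \<in> lamps" "v \<in> carrier ?G"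
      using t(3) g(2) by (auto simp: v_def finite_dihedral_act)
    obtain f where f: "f \<in> F" "v \<otimes>\<^bsub>?G\<^esub> inv\<^bsub>?G\<^esub> f \<in> H" using F(3) v(1) by blast
    have fC: "f \<in> carrier ?G" using f F(2) by blast
    have "t \<otimes>\<^bsub>?G\<^esub> g = v \<otimes>\<^bsub>?G\<^esub> d"
      by (auto simp: t_def g(1) v_def d_def dihedral_act_simps minus_div_mult_eq_mod[symmetric])
    then have "g = inv\<^bsub>?G\<^esub> t \<otimes>\<^bsub>?G\<^esub> (v \<otimes>\<^bsub>?G\<^esub> d)"
      using gC t(2) by (metis dihedral_lamp.inv_solve_left dihedral_lamp.m_closed v(2) dC)
    then have "g \<otimes>\<^bsub>?G\<^esub> inv\<^bsub>?G\<^esub> (f \<otimes>\<^bsub>?G\<^esub> d) = inv\<^bsub>?G\<^esub> t \<otimes>\<^bsub>?G\<^esub> (v \<otimes>\<^bsub>?G\<^esub> inv\<^bsub>?G\<^esub> f)"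
      using dihedral_lamp.div_mult_cancel[of "v" "f" "inv\<^bsub>?G\<^esub> d"] t(2) v(2) dC fC
      by (simp add: dihedral_lamp.m_assoc)
    also have "\<dots> \<in> H"
      by (rule subgroup.m_closed[OF sub subgroup.m_inv_closed[OF sub t(1)] f(2)])
    finally show ?thesis using f(1) d by blast
  qed
  moreover have "finite ?E" using F(1) by simp
  moreover have "?E \<subseteq> carrier ?G"
  proof (rule image_subsetI)
    fix p :: "(int set \<times> int \<times> int) \<times> int set \<times> int \<times> int"
    assume "p \<in> F \<times> ?D"
    then have p: "fst p \<in> F" "snd p \<in> ?D" by (simp_all only: mem_Times_iff)
    then have "fst p \<in> carrier ?G" "snd p \<in> carrier ?G" using F(2) by auto
    then show "(case p of (f, d) \<Rightarrow> f \<otimes>\<^bsub>?G\<^esub> d) \<in> carrier ?G" by (simp add: case_prod_beta)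
  qed
  ultimately show ?thesis by (rule almost_subsetI)
qed

text \<open>Two orientation-reversing elements of \<open>H\<close> have an orientation-preserving
  quotient, which is a configuration by assumption. So the identity and at most one reversing
  element suffice as representatives.\<close>

lemma no_translation_almost_subset:
  assumes sub: "subgroup H dihedral_lamp"
    and none: "\<And>S n. (S, 1, n) \<in> H \<Longrightarrow> n = 0"
  shows "almost_subset dihedral_lamp H (H \<inter> lamps)"
proof -
  let ?G = dihedral_lamp
  have HC: "H \<subseteq> carrier ?G" by (rule subgroup.subset[OF sub])
  have direct: "(S, 1, n) \<in> lamps" if "(S, 1, n) \<in> H" for S n
    using that none HC by auto
  show ?thesis
  proof (cases "\<exists>S n. (S, -1, n) \<in> H")
    case False
    have "H \<subseteq> H \<inter> lamps"
    proof
      fix x assume x: "x \<in> H"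
      obtain S e n where "x = (S, e, n)" by (cases x)
      with x False HC direct show "x \<in> H \<inter> lamps" by (cases "e = 1") auto
    qed
    then show ?thesis by (rule dihedral_lamp.subset_imp_almost_subset[OF _ HC])
  next
    case True
    then obtain R k where r: "(R, -1, k) \<in> H" by blast
    have R: "finite R" using r HC by auto
    have "\<exists>f\<in>{({}, 1, 0), (R, -1, k)}. x \<otimes>\<^bsub>?G\<^esub> inv\<^bsub>?G\<^esub> f \<in> H \<inter> lamps" if x: "x \<in> H" for x
    proof -
      obtain S e n where xe: "x = (S, e, n)" by (cases x)
      have e: "e = 1 \<or> e = -1" using x xe HC by auto
      then show ?thesis
      proof
        assume "e = 1"
        then show ?thesis using x xe direct by (simp add: dihedral_act_def)
      next
        assume e: "e = -1"
        have "x \<otimes>\<^bsub>?G\<^esub> inv\<^bsub>?G\<^esub> (R, -1, k) \<in> H"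
          using x r sub by (intro subgroup.m_closed subgroup.m_inv_closed)
        moreover from this have "x \<otimes>\<^bsub>?G\<^esub> inv\<^bsub>?G\<^esub> (R, -1, k) \<in> lamps"
          using R xe e direct by (simp add: finite_dihedral_act del: in_lamps)
        ultimately show ?thesis by blast
      qed
    qed
    moreover have "{({}, 1, 0), (R, -1, k)} \<subseteq> carrier ?G" using R by auto
    ultimately show ?thesis
      unfolding almost_subset_def by (intro exI[of _ "{({}, 1, 0), (R, -1, k)}"]) auto
  qed
qed

lemma icn_dihedral_lamp: "inner_commensurator_normalizer dihedral_lamp"
  unfolding inner_commensurator_normalizer_def
proof (intro allI impI)
  let ?G = dihedral_lamp
  fix H assume H: "commensurated ?G H"
  have sub: "subgroup H ?G" using H by (simp add: commensurated_def)
  have HC: "H \<subseteq> carrier ?G" by (rule subgroup.subset[OF sub])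
  show "\<exists>N. N \<lhd> ?G \<and> commensurable ?G H N"
  proof (cases "\<exists>S n. (S, 1, n) \<in> H \<and> n \<noteq> 0")
    case True
    then have "almost_subset ?G (carrier ?G) H"
      using translation_imp_almost_full[OF H] by blast
    then have "commensurable ?G H (carrier ?G)"
      using sub dihedral_lamp.subgroup_self dihedral_lamp.subset_imp_almost_subset[OF HC HC]
      by (simp add: dihedral_lamp.commensurable_iff)
    moreover have "carrier ?G \<lhd> ?G"
      by (rule dihedral_lamp.normal_invI) (auto intro: dihedral_lamp.subgroup_self)
    ultimately show ?thesis by blast
  next
    case False
    then have al: "almost_subset ?G H (H \<inter> lamps)"
      using no_translation_almost_subset[OF sub] by blast
    show ?thesis
    proof (cases "finite {S. (S, 1, 0) \<in> H}")
      case True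
      have "H \<inter> lamps \<subseteq> (\<lambda>S. (S, 1, 0)) ` {S. (S, 1, 0) \<in> H}" by (auto simp: lamps_def)
      then have "finite (H \<inter> lamps)" using True finite_surj by blast
      then have "finite H" using dihedral_lamp.almost_subset_finite[OF al HC] by blast
      \<comment> \<open>The finite set \<open>H\<close> itself serves as the set of translating
        elements: every \<open>x\<close> is matched with itself.\<close>
      then have "almost_subset ?G H {\<one>\<^bsub>?G\<^esub>}"
        unfolding almost_subset_def using HC dihedral_lamp.r_inv by (intro exI[of _ H]) blast
      moreover have "almost_subset ?G {\<one>\<^bsub>?G\<^esub>} H"
        using subgroup.one_closed[OF sub] HC
        by (intro dihedral_lamp.subset_imp_almost_subset) auto
      ultimately have "commensurable ?G H {\<one>\<^bsub>?G\<^esub>}"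
        using sub dihedral_lamp.triv_subgroup by (simp add: dihedral_lamp.commensurable_iff)
      then show ?thesis using dihedral_lamp.one_is_normal by blast
    next
      case False
      have "almost_subset ?G H lamps" using al almost_subset_mono by blast
      then have "commensurable ?G H lamps"
        using sub infinite_lamps_almost_full[OF H False] normal_imp_subgroup[OF normal_lamps]
        by (simp add: dihedral_lamp.commensurable_iff)
      then show ?thesis using normal_lamps by blast
    qed
  qed
qed

section \<open>The index two subgroup of translations\<close>

definition orientation_preserving :: "(int set \<times> int \<times> int) set" where
  "orientation_preserving = {(S, e, n). finite S \<and> e = 1}"

lemma in_orientation_preserving [simp]:
  "(S, e, n) \<in> orientation_preserving \<longleftrightarrow> finite S \<and> e = 1"
  by (simp add: orientation_preserving_def)

lemma subgroup_orientation_preserving: "subgroup orientation_preserving dihedral_lamp"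
  by (rule dihedral_lamp.subgroupI) (auto simp: orientation_preserving_def finite_dihedral_act)

lemma finite_index_orientation_preserving: "finite_index orientation_preserving dihedral_lamp"
  unfolding dihedral_lamp.finite_index_iff almost_subset_def
proof (intro conjI exI ballI)
  let ?F = "{({}, 1, 0), ({}, -1, 0)} :: (int set \<times> int \<times> int) set"
  show "finite ?F" "?F \<subseteq> carrier dihedral_lamp" by auto
  fix x assume "x \<in> carrier dihedral_lamp"
  then show "\<exists>f\<in>?F. x \<otimes>\<^bsub>dihedral_lamp\<^esub> inv\<^bsub>dihedral_lamp\<^esub> f \<in> orientation_preserving"
    by (cases x) (auto simp: finite_dihedral_act)
qed (rule subgroup_orientation_preserving)

definition right_lamps :: "(int set \<times> int \<times> int) set" where
  "right_lamps = {(S, e, n). finite S \<and> S \<subseteq> {0..} \<and> e = 1 \<and> n = 0}"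

text \<open>A shift pushes a set of nonnegative integers only finitely far below zero, so
  \<open>right_lamps\<close> is commensurated. A normal subgroup commensurable with it would contain
  a nonempty configuration together with all its shifts, and shifts far to the left escape every
  finite union of translates of \<open>right_lamps\<close>.\<close>

lemma not_icn_orientation_preserving:
  "\<not> inner_commensurator_normalizer (dihedral_lamp\<lparr>carrier := orientation_preserving\<rparr>)"
proof
  let ?L = "dihedral_lamp\<lparr>carrier := orientation_preserving\<rparr>"
  assume icn: "inner_commensurator_normalizer ?L"
  interpret L: group ?L
    by (rule dihedral_lamp.subgroup_imp_group[OF subgroup_orientation_preserving])
  have inv: "inv\<^bsub>?L\<^esub> (S, 1, n) = (dihedral_act 1 (- n) S, 1, - n)" if "finite S" for S n
    using dihedral_lamp.m_inv_consistent[OF subgroup_orientation_preserving, of "(S, 1, n)"] that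
    by simp
  \<comment> \<open>Configurations commute and are their own inverses, so \<open>S\<close> cancels
    and only the shift by \<open>n\<close> is felt.\<close>
  have conj: "(S, 1, n) \<otimes>\<^bsub>?L\<^esub> (T, 1, 0) \<otimes>\<^bsub>?L\<^esub> inv\<^bsub>?L\<^esub> (S, 1, n) = (dihedral_act 1 n T, 1, 0)"
    if "finite S" for S n T
    using that by (simp add: inv dihedral_act_act dihedral_act_sym_diff) blast
  have RL: "right_lamps \<subseteq> orientation_preserving"
    by (auto simp: right_lamps_def)
  have sub: "subgroup right_lamps ?L"
  proof (rule L.subgroupI)
    fix x y assume "x \<in> right_lamps" "y \<in> right_lamps"
    then obtain S T where "x = (S, 1, 0)" "finite S" "S \<subseteq> {0..}" "y = (T, 1, 0)" "finite T" "T \<subseteq> {0..}"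
      by (auto simp: right_lamps_def)
    moreover from this have "sym_diff S T \<subseteq> {0..}" by blast
    ultimately show "inv\<^bsub>?L\<^esub> x \<in> right_lamps" "x \<otimes>\<^bsub>?L\<^esub> y \<in> right_lamps"
      by (simp_all add: inv right_lamps_def)
  qed (auto simp: right_lamps_def)
  have "almost_subset ?L ((\<lambda>x. g \<otimes>\<^bsub>?L\<^esub> x \<otimes>\<^bsub>?L\<^esub> inv\<^bsub>?L\<^esub> g) ` right_lamps) right_lamps"
    if "g \<in> carrier ?L" for g
  proof -
    obtain S e n where g': "g = (S, e, n)" by (rule prod_cases3)
    have g: "g = (S, 1, n)" "finite S" using that by (simp_all add: g')
    \<comment> \<open>These are the possible parts below zero after a shift by \<open>n\<close>; for
      \<open>n\<close> at least 0 the interval is empty.\<close>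
    let ?F = "(\<lambda>U. (U, 1, 0)) ` Pow {n..<0}"
    have "\<exists>f\<in>?F. x \<otimes>\<^bsub>?L\<^esub> inv\<^bsub>?L\<^esub> f \<in> right_lamps"
      if x: "x \<in> (\<lambda>x. g \<otimes>\<^bsub>?L\<^esub> x \<otimes>\<^bsub>?L\<^esub> inv\<^bsub>?L\<^esub> g) ` right_lamps" for x
    proof -
      obtain T where T: "x = (dihedral_act 1 n T, 1, 0)" "finite T" "T \<subseteq> {0..}"
        using x conj[OF g(2)] by (auto simp: right_lamps_def g(1))
      define U where "U = dihedral_act 1 n T \<inter> {..<0}"
      have fin: "finite (dihedral_act 1 n T)" by (rule finite_dihedral_act) (auto simp: T)
      have "x \<otimes>\<^bsub>?L\<^esub> inv\<^bsub>?L\<^esub> (U, 1, 0) \<in> right_lamps"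
      proof -
        have "finite U" using fin by (simp add: U_def)
        then have "x \<otimes>\<^bsub>?L\<^esub> inv\<^bsub>?L\<^esub> (U, 1, 0) = (sym_diff (dihedral_act 1 n T) U, 1, 0)"
          by (simp add: inv T(1))
        moreover have "sym_diff (dihedral_act 1 n T) U \<subseteq> {0..}" by (auto simp: U_def)
        ultimately show ?thesis using fin \<open>finite U\<close> by (simp add: right_lamps_def)
      qed
      moreover have "U \<in> Pow {n..<0}"
        using T(3) by (fastforce simp: U_def dihedral_act_simps)
      ultimately show ?thesis by blast
    qed
    moreover have "finite ?F" "?F \<subseteq> carrier ?L"
      using finite_subset[OF _ finite_atLeastLessThan_int] by auto
    ultimately show ?thesis by (rule almost_subsetI)
  qed
  then have "commensurated ?L right_lamps" using L.commensurated_iff sub by blast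
  then obtain N where N: "N \<lhd> ?L" "commensurable ?L right_lamps N"
    using icn unfolding inner_commensurator_normalizer_def by blast
  have subN: "subgroup N ?L" by (rule normal_imp_subgroup[OF N(1)])
  have NL: "N \<subseteq> orientation_preserving" using subgroup.subset[OF subN] by simp
  have RN: "almost_subset ?L right_lamps N" and NR: "almost_subset ?L N right_lamps"
    using N(2) by (auto simp: L.commensurable_iff)
  \<comment> \<open>Otherwise \<open>N\<close> would meet \<open>right_lamps\<close> only in the
    identity, and the almost inclusion would make the infinite group \<open>right_lamps\<close>
    finite.\<close>
  have "\<exists>S. S \<noteq> {} \<and> (S, 1, 0) \<in> N"
  proof (rule ccontr)
    assume none: "\<not> (\<exists>S. S \<noteq> {} \<and> (S, 1, 0) \<in> N)"
    have "almost_subset ?L right_lamps (N \<inter> right_lamps)"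
      by (rule L.almost_subset_Int[OF RN sub subN])
    moreover have "N \<inter> right_lamps \<subseteq> {({}, 1, 0)}"
      using none by (auto simp: right_lamps_def)
    ultimately have "finite right_lamps"
      using L.almost_subset_finite[of right_lamps "N \<inter> right_lamps"] RL finite_subset by auto
    moreover have "(\<lambda>x. ({x}, 1, 0)) ` {0..} \<subseteq> right_lamps"
      by (auto simp: right_lamps_def)
    ultimately have "finite ((\<lambda>x. ({x}, 1 :: int, 0 :: int)) ` {0::int..})"
      using finite_subset by blast
    then have "finite {0::int..}"
      by (rule finite_imageD) (auto simp: inj_on_def)
    then show False by (simp add: infinite_Ici)
  qed
  then obtain S s where S: "(S, 1, 0) \<in> N" "s \<in> S" by blast
  obtain F where F: "finite F" "F \<subseteq> N"
    "\<And>x. x \<in> N \<Longrightarrow> \<exists>f\<in>F. x \<otimes>\<^bsub>?L\<^esub> inv\<^bsub>?L\<^esub> f \<in> right_lamps"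
    by (rule L.almost_subset_reps[OF NR sub]) (use NL in auto)
  have FL: "F \<subseteq> orientation_preserving" using F(2) NL by blast
  then have "finite (\<Union>(fst ` F))" using F(1) by (auto simp: orientation_preserving_def)
  then obtain b where b: "b \<ge> 0" "\<Union>(fst ` F) \<subseteq> {-b..b}" using bounded_int_set by blast
  \<comment> \<open>This shift takes the lamp at \<open>s\<close> to \<open>-b - 1\<close>, just to
    the left of the interval \<open>{-b..b}\<close> that contains the configurations of all
    representatives.\<close>
  define n where "n = - (s + b + 1)"
  have "({}, 1, n) \<otimes>\<^bsub>?L\<^esub> (S, 1, 0) \<otimes>\<^bsub>?L\<^esub> inv\<^bsub>?L\<^esub> ({}, 1, n) \<in> N"
    by (rule L.normal_invE(2)[OF N(1)]) (use S in auto)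
  then have "(dihedral_act 1 n S, 1, 0) \<in> N" using conj[of "{}" n S] by simp
  then obtain f where f: "f \<in> F" "(dihedral_act 1 n S, 1, 0) \<otimes>\<^bsub>?L\<^esub> inv\<^bsub>?L\<^esub> f \<in> right_lamps"
    using F(3) by blast
  obtain T k where T: "f = (T, 1, k)" "finite T" using f(1) FL by (cases f) auto
  \<comment> \<open>The quotient has translation part \<open>-k\<close>, which must vanish in
    \<open>right_lamps\<close>.\<close>
  have "k = 0" using f(2) T by (simp add: inv right_lamps_def)
  then have "sym_diff (dihedral_act 1 n S) T \<subseteq> {0..}"
    using f(2) T by (simp add: inv right_lamps_def)
  moreover have "- b - 1 \<in> dihedral_act 1 n S" using S(2) by (simp add: dihedral_act_def n_def)
  moreover have "- b - 1 \<notin> T" using b(2) f(1) T(1) by force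
  ultimately have "- b - 1 \<in> {0..}" by blast
  then show False using b(1) by simp
qed

section \<open>Transfer of the example to the natural numbers\<close>

theorem theorem5p2:
  shows "\<exists>(\<Gamma> :: nat monoid) \<Lambda>.
           group \<Gamma> \<and> countable (carrier \<Gamma>) \<and>
           inner_commensurator_normalizer \<Gamma> \<and>
           finite_index \<Lambda> \<Gamma> \<and>
           \<not> inner_commensurator_normalizer (\<Gamma>\<lparr>carrier := \<Lambda>\<rparr>)"
proof -
  let ?G = dihedral_lamp and ?L = orientation_preserving
  obtain \<Gamma> :: "nat monoid" and h where \<Gamma>: "group \<Gamma>" and h: "h \<in> iso ?G \<Gamma>"
    using countable_group_iso_nat[OF group_dihedral_lamp countable_dihedral_lamp] by blast
  interpret \<Gamma>: group \<Gamma> by (rule \<Gamma>)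
  have hom: "h \<in> hom ?G \<Gamma>" and bij: "bij_betw h (carrier ?G) (carrier \<Gamma>)"
    using h by (auto simp: iso_def)
  interpret group_hom ?G \<Gamma> h
    using hom by (simp add: group_hom_def group_hom_axioms_def \<Gamma> group_dihedral_lamp)
  have sub: "subgroup (h ` ?L) \<Gamma>"
    by (rule subgroup_img_is_subgroup[OF subgroup_orientation_preserving])
  have LC: "?L \<subseteq> carrier ?G" by (rule subgroup.subset[OF subgroup_orientation_preserving])
  have "finite_index (h ` ?L) \<Gamma>"
    using finite_index_orientation_preserving sub bij
      almost_subset_image[OF group_dihedral_lamp \<Gamma> hom order_refl]
    by (simp add: dihedral_lamp.finite_index_iff \<Gamma>.finite_index_iff bij_betw_def)
  moreover have "inner_commensurator_normalizer \<Gamma>"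
    by (rule inner_commensurator_normalizer_iso[OF group_dihedral_lamp \<Gamma> h icn_dihedral_lamp])
  moreover have "\<not> inner_commensurator_normalizer (\<Gamma>\<lparr>carrier := h ` ?L\<rparr>)"
  proof
    assume icn: "inner_commensurator_normalizer (\<Gamma>\<lparr>carrier := h ` ?L\<rparr>)"
    \<comment> \<open>The isomorphism restricts to the index two subgroup, so the property for the
      image would pull back to \<open>?L\<close>, where it fails.\<close>
    have "h \<in> iso (?G\<lparr>carrier := ?L\<rparr>) (\<Gamma>\<lparr>carrier := h ` ?L\<rparr>)"
      using hom bij LC by (auto simp: iso_def hom_def bij_betw_def subset_eq inj_on_def)
    then have "inv_into ?L h \<in> iso (\<Gamma>\<lparr>carrier := h ` ?L\<rparr>) (?G\<lparr>carrier := ?L\<rparr>)"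
      using group.iso_set_sym[OF dihedral_lamp.subgroup_imp_group[OF subgroup_orientation_preserving]]
      by fastforce
    then have "inner_commensurator_normalizer (?G\<lparr>carrier := ?L\<rparr>)"
      using inner_commensurator_normalizer_iso[OF \<Gamma>.subgroup_imp_group[OF sub]
          dihedral_lamp.subgroup_imp_group[OF subgroup_orientation_preserving] _ icn] by blast
    then show False using not_icn_orientation_preserving by blast
  qed
  ultimately show ?thesis using \<Gamma> by blast
qed

end
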